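(* The following three conditions on a semigroup $S$ are equivalent. (i) $S$ is a semilattice indecomposable left legal semigroup. (ii) $S$ is a left legal semigroup satisfying the identity $a^2b=a^2$. (iii) $S^2$ is a left zero semigroup.
   Context: A semigroup is a nonempty set with an associative multiplication, and $S^2=\{ab: a,b\in S\}$, which is an ideal (hence a subsemigroup) of $S$. A semigroup is left legal if it satisfies the identity $aba=ab$. A left zero semigroup is a semigroup satisfying the identity $ab=a$. A semilattice is a commutative semigroup in which every element is idempotent. A semilattice congruence on a semigroup $S$ is a congruence $\varrho$ on $S$ such that $S/\varrho$ is a semilattice. A semigroup $S$ is semilattice indecomposable if the universal relation $S\times S$ is the only semilattice congruence on $S$. *)

theory Defs
  imports Main
begin

text \<open>
  Semigroups are given by an explicit carrier set and an operation that is only constrained on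
  that carrier. This allows a subset of a semigroup, or a quotient whose elements are congruence
  classes, to be treated as a semigroup in its own right.
\<close>

locale semigroup_on =
  fixes S :: "'a set"
    and mult :: "'a \<Rightarrow> 'a \<Rightarrow> 'a"  (infixl "\<cdot>" 70)
  assumes nonempty: "S \<noteq> {}"
    and closed: "a \<in> S \<Longrightarrow> b \<in> S \<Longrightarrow> a \<cdot> b \<in> S"
    and assoc: "a \<in> S \<Longrightarrow> b \<in> S \<Longrightarrow> c \<in> S \<Longrightarrow> a \<cdot> b \<cdot> c = a \<cdot> (b \<cdot> c)"

locale left_legal_semigroup = semigroup_on +
  assumes left_legal: "a \<in> S \<Longrightarrow> b \<in> S \<Longrightarrow> a \<cdot> b \<cdot> a = a \<cdot> b"

locale left_zero_semigroup = semigroup_on +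
  assumes left_zero: "a \<in> S \<Longrightarrow> b \<in> S \<Longrightarrow> a \<cdot> b = a"

locale semilattice_on = semigroup_on +
  assumes commute: "a \<in> S \<Longrightarrow> b \<in> S \<Longrightarrow> a \<cdot> b = b \<cdot> a"
    and idem: "a \<in> S \<Longrightarrow> a \<cdot> a = a"

definition square :: "'a set \<Rightarrow> ('a \<Rightarrow> 'a \<Rightarrow> 'a) \<Rightarrow> 'a set"
  where "square S mult = {mult a b | a b. a \<in> S \<and> b \<in> S}"

definition congruence_on :: "'a set \<Rightarrow> ('a \<Rightarrow> 'a \<Rightarrow> 'a) \<Rightarrow> ('a \<times> 'a) set \<Rightarrow> bool"
  where "congruence_on S mult \<rho> \<longleftrightarrow>
    equiv S \<rho> \<and>
    (\<forall>a b c d. (a, b) \<in> \<rho> \<longrightarrow> (c, d) \<in> \<rho> \<longrightarrow> (mult a c, mult b d) \<in> \<rho>)"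

text \<open>
  Multiplication of classes. For a congruence, all classes in the union coincide
  (see \<open>quotient_mult_classes\<close>).
\<close>

definition quotient_mult ::
    "('a \<Rightarrow> 'a \<Rightarrow> 'a) \<Rightarrow> ('a \<times> 'a) set \<Rightarrow> 'a set \<Rightarrow> 'a set \<Rightarrow> 'a set"
  where "quotient_mult mult \<rho> A B = (\<Union>a\<in>A. \<Union>b\<in>B. \<rho> `` {mult a b})"

lemma quotient_mult_classes:
  assumes "congruence_on S mult \<rho>" "a \<in> S" "b \<in> S"
  shows "quotient_mult mult \<rho> (\<rho> `` {a}) (\<rho> `` {b}) = \<rho> `` {mult a b}"
proof -
  have eq: "equiv S \<rho>"
    and cong: "\<And>a b c d. (a, b) \<in> \<rho> \<Longrightarrow> (c, d) \<in> \<rho> \<Longrightarrow> (mult a c, mult b d) \<in> \<rho>"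
    using assms(1) unfolding congruence_on_def by blast+
  have "a \<in> \<rho> `` {a}" "b \<in> \<rho> `` {b}"
    using eq assms(2,3) by (simp_all add: equiv_class_self del: Image_singleton_iff)
  moreover have "\<rho> `` {mult x y} = \<rho> `` {mult a b}" if "x \<in> \<rho> `` {a}" "y \<in> \<rho> `` {b}" for x y
    using that cong[of a x b y] equiv_class_eq[OF eq] by auto
  ultimately show ?thesis
    unfolding quotient_mult_def by blast
qed

definition semilattice_congruence :: "'a set \<Rightarrow> ('a \<Rightarrow> 'a \<Rightarrow> 'a) \<Rightarrow> ('a \<times> 'a) set \<Rightarrow> bool"
  where "semilattice_congruence S mult \<rho> \<longleftrightarrow>
    congruence_on S mult \<rho> \<and> semilattice_on (S // \<rho>) (quotient_mult mult \<rho>)"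

definition semilattice_indecomposable :: "'a set \<Rightarrow> ('a \<Rightarrow> 'a \<Rightarrow> 'a) \<Rightarrow> bool"
  where "semilattice_indecomposable S mult \<longleftrightarrow>
    (\<forall>\<rho>. semilattice_congruence S mult \<rho> \<longleftrightarrow> \<rho> = S \<times> S)"

end

theory Submission
  imports Defs
begin

text \<open>
  In a left legal semigroup all products are idempotent, and the relation \<open>a\<^sup>2b = a\<^sup>2\<close> is a
  compatible preorder. Its symmetric part is a semilattice congruence, so indecomposability
  forces \<open>a\<^sup>2b = a\<^sup>2\<close> throughout. Conversely, under this identity every semilattice congruence
  relates \<open>a\<close> to \<open>a\<^sup>2 = a\<^sup>2b\<close>, hence to \<open>ab\<close>, and by commutativity to \<open>ba\<close> and \<open>b\<close>.
\<close>

context semigroup_on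
begin

text \<open>Closure and associativity pass from \<open>S\<close> to the classes, so only idempotence
  and commutativity impose conditions. Since two classes agree exactly when their representatives
  are related, these conditions become memberships in \<open>\<rho>\<close>, and later arguments can
  work with elements alone.\<close>

lemma quotient_semilattice_iff:
  assumes cong: "congruence_on S mult \<rho>"
  shows "semilattice_on (S // \<rho>) (quotient_mult mult \<rho>) \<longleftrightarrow>
    (\<forall>a\<in>S. (a \<cdot> a, a) \<in> \<rho>) \<and> (\<forall>a\<in>S. \<forall>b\<in>S. (a \<cdot> b, b \<cdot> a) \<in> \<rho>)"
proof -
  have eq: "equiv S \<rho>"
    using cong by (simp add: congruence_on_def)
  note classes = quotient_mult_classes[OF cong]
  note class_eq_iff = eq_equiv_class_iff[OF eq]
  have quotI: "\<rho> `` {a} \<in> S // \<rho>" if "a \<in> S" for a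
    using that by (rule quotientI)
  show ?thesis
  proof
    assume "semilattice_on (S // \<rho>) (quotient_mult mult \<rho>)"
    then interpret Q: semilattice_on "S // \<rho>" "quotient_mult mult \<rho>" .
    have "(a \<cdot> a, a) \<in> \<rho>" if "a \<in> S" for a
      using Q.idem[OF quotI[OF that]] that by (simp add: classes class_eq_iff closed)
    moreover have "(a \<cdot> b, b \<cdot> a) \<in> \<rho>" if "a \<in> S" "b \<in> S" for a b
      using Q.commute[OF quotI quotI, of a b] that by (simp add: classes class_eq_iff closed)
    ultimately show "(\<forall>a\<in>S. (a \<cdot> a, a) \<in> \<rho>) \<and> (\<forall>a\<in>S. \<forall>b\<in>S. (a \<cdot> b, b \<cdot> a) \<in> \<rho>)"
      by blast
  next
    assume rel: "(\<forall>a\<in>S. (a \<cdot> a, a) \<in> \<rho>) \<and> (\<forall>a\<in>S. \<forall>b\<in>S. (a \<cdot> b, b \<cdot> a) \<in> \<rho>)"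
    show "semilattice_on (S // \<rho>) (quotient_mult mult \<rho>)"
    proof
      show "S // \<rho> \<noteq> {}"
        using nonempty quotI by blast
    next
      fix A B assume "A \<in> S // \<rho>" "B \<in> S // \<rho>"
      then show "quotient_mult mult \<rho> A B \<in> S // \<rho>"
        by (elim quotientE) (simp only: classes closed quotI)
    next
      fix A B C assume "A \<in> S // \<rho>" "B \<in> S // \<rho>" "C \<in> S // \<rho>"
      then show "quotient_mult mult \<rho> (quotient_mult mult \<rho> A B) C =
          quotient_mult mult \<rho> A (quotient_mult mult \<rho> B C)"
        by (elim quotientE) (simp only: classes closed assoc)
    next
      fix A B assume "A \<in> S // \<rho>" "B \<in> S // \<rho>"
      then show "quotient_mult mult \<rho> A B = quotient_mult mult \<rho> B A"
        using rel by (elim quotientE) (simp only: classes closed class_eq_iff)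
    next
      fix A assume "A \<in> S // \<rho>"
      then show "quotient_mult mult \<rho> A A = A"
        using rel by (elim quotientE) (simp only: classes closed class_eq_iff)
    qed
  qed
qed

lemma semilattice_congruence_iff:
  "semilattice_congruence S mult \<rho> \<longleftrightarrow> congruence_on S mult \<rho> \<and>
    (\<forall>a\<in>S. (a \<cdot> a, a) \<in> \<rho>) \<and> (\<forall>a\<in>S. \<forall>b\<in>S. (a \<cdot> b, b \<cdot> a) \<in> \<rho>)"
  unfolding semilattice_congruence_def by (rule conj_cong[OF refl quotient_semilattice_iff])

text \<open>Indecomposability is defined by an equivalence; this settles the direction that holds in
  every semigroup.\<close>

lemma semilattice_congruence_universal: "semilattice_congruence S mult (S \<times> S)"
  unfolding semilattice_congruence_iff congruence_on_def
  by (auto simp: equiv_def refl_on_def sym_def trans_def closed)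

lemma semilattice_indecomposable_if_square_absorbs:
  assumes absorb: "\<And>a b. a \<in> S \<Longrightarrow> b \<in> S \<Longrightarrow> a \<cdot> a \<cdot> b = a \<cdot> a"
  shows "semilattice_indecomposable S mult"
proof -
  have "\<rho> = S \<times> S" if "semilattice_congruence S mult \<rho>" for \<rho>
  proof -
    have eq: "equiv S \<rho>"
      and compat: "\<And>a b c d. (a, b) \<in> \<rho> \<Longrightarrow> (c, d) \<in> \<rho> \<Longrightarrow> (a \<cdot> c, b \<cdot> d) \<in> \<rho>"
      and idem: "\<And>a. a \<in> S \<Longrightarrow> (a \<cdot> a, a) \<in> \<rho>"
      and commute: "\<And>a b. a \<in> S \<Longrightarrow> b \<in> S \<Longrightarrow> (a \<cdot> b, b \<cdot> a) \<in> \<rho>"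
      using that unfolding semilattice_congruence_iff congruence_on_def by blast+
    have refl: "(a, a) \<in> \<rho>" if "a \<in> S" for a
      using eq that by (auto simp: equiv_def refl_on_def)
    have sym: "(b, a) \<in> \<rho>" if "(a, b) \<in> \<rho>" for a b
      using eq that by (auto simp: equiv_def sym_def)
    have trans: "(a, c) \<in> \<rho>" if "(a, b) \<in> \<rho>" "(b, c) \<in> \<rho>" for a b c
      using eq that unfolding equiv_def trans_def by blast
    \<comment> \<open>Multiplying \<open>a \<cdot> a\<close> and \<open>a\<close> by
      \<open>b\<close> on the right relates \<open>a \<cdot> a \<cdot> b\<close> to
      \<open>a \<cdot> b\<close>; the former equals \<open>a \<cdot> a\<close>, which is related to
      \<open>a\<close>.\<close>
    have left: "(a, a \<cdot> b) \<in> \<rho>" if "a \<in> S" "b \<in> S" for a b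
      using compat[OF idem refl, of a b] idem[of a] absorb[of a b] that
      by (metis sym trans)
    have "(a, b) \<in> \<rho>" if "a \<in> S" "b \<in> S" for a b
      using left that commute by (meson sym trans)
    moreover have "\<rho> \<subseteq> S \<times> S"
      using eq by (rule equiv_type)
    ultimately show ?thesis
      by auto
  qed
  then show ?thesis
    unfolding semilattice_indecomposable_def using semilattice_congruence_universal by blast
qed

lemma left_legal_if_left_zero_square:
  assumes "left_zero_semigroup (square S mult) mult"
  shows "left_legal_semigroup S mult"
    and "\<And>a b. a \<in> S \<Longrightarrow> b \<in> S \<Longrightarrow> a \<cdot> a \<cdot> b = a \<cdot> a"
proof -
  interpret Q: left_zero_semigroup "square S mult" mult
    by (rule assms)
  have sq: "a \<cdot> b \<in> square S mult" if "a \<in> S" "b \<in> S" for a b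
    using that by (auto simp: square_def)
  \<comment> \<open>As \<open>c\<close> may lie outside the square, the left zero law does not apply
    to it directly. Doubling the idempotent \<open>a \<cdot> b\<close> supplies a right factor
    \<open>a \<cdot> b \<cdot> c\<close> that is a product.\<close>
  have absorb: "a \<cdot> b \<cdot> c = a \<cdot> b" if "a \<in> S" "b \<in> S" "c \<in> S" for a b c
  proof -
    have "a \<cdot> b \<cdot> c = a \<cdot> b \<cdot> (a \<cdot> b) \<cdot> c"
      using that by (simp add: Q.left_zero sq)
    also have "\<dots> = a \<cdot> b \<cdot> (a \<cdot> b \<cdot> c)"
      using that by (intro assoc) (simp_all add: closed)
    also have "\<dots> = a \<cdot> b"
      using that by (intro Q.left_zero) (simp_all add: sq closed)
    finally show ?thesis .
  qed
  show "left_legal_semigroup S mult"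
    by unfold_locales (simp add: absorb)
  show "a \<cdot> a \<cdot> b = a \<cdot> a" if "a \<in> S" "b \<in> S" for a b
    using that by (simp add: absorb)
qed

end

context left_legal_semigroup
begin

text \<open>Legality read backwards inserts an \<open>a\<close>, turning \<open>abb\<close> into
  \<open>abab\<close>; then \<open>bab\<close> shrinks to \<open>ba\<close>, and \<open>aba\<close>
  to \<open>ab\<close>.\<close>

lemma mult_absorb_right:
  assumes "a \<in> S" "b \<in> S"
  shows "a \<cdot> b \<cdot> b = a \<cdot> b"
proof -
  have "a \<cdot> b \<cdot> b = a \<cdot> b \<cdot> a \<cdot> b"
    using assms by (simp add: left_legal)
  also have "\<dots> = a \<cdot> (b \<cdot> a \<cdot> b)"
    using assms by (simp add: assoc closed)
  also have "\<dots> = a \<cdot> b \<cdot> a"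
    using assms left_legal[of b a] by (simp add: assoc)
  finally show ?thesis
    using assms by (simp add: left_legal)
qed

lemma mult_idem:
  assumes "a \<in> S" "b \<in> S"
  shows "a \<cdot> b \<cdot> (a \<cdot> b) = a \<cdot> b"
  using assms by (simp add: assoc[symmetric] closed left_legal mult_absorb_right)

text \<open>By legality \<open>ab = aba = abaa\<close>, so the product ends in the square of
  \<open>a\<close>, which swallows \<open>c\<close>.\<close>

lemma mult_absorb_if_left_factor:
  assumes S: "a \<in> S" "b \<in> S" "c \<in> S" and absorb: "a \<cdot> a \<cdot> c = a \<cdot> a"
  shows "a \<cdot> b \<cdot> c = a \<cdot> b"
proof -
  have ab: "a \<cdot> b = a \<cdot> b \<cdot> (a \<cdot> a)"
    using S by (simp add: assoc[symmetric] closed left_legal)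
  then have "a \<cdot> b \<cdot> c = a \<cdot> b \<cdot> (a \<cdot> a \<cdot> c)"
    using S by (metis assoc closed)
  then show ?thesis
    by (simp only: absorb ab[symmetric])
qed

text \<open>Here \<open>ab = abb\<close> ends in the square of \<open>b\<close>, which swallows
  \<open>c\<close>.\<close>

lemma mult_absorb_if_right_factor:
  assumes S: "a \<in> S" "b \<in> S" "c \<in> S" and absorb: "b \<cdot> b \<cdot> c = b \<cdot> b"
  shows "a \<cdot> b \<cdot> c = a \<cdot> b"
proof -
  have ab: "a \<cdot> b = a \<cdot> (b \<cdot> b)"
    using S by (simp add: assoc[symmetric] mult_absorb_right)
  then have "a \<cdot> b \<cdot> c = a \<cdot> (b \<cdot> b \<cdot> c)"
    using S by (metis assoc closed)
  then show ?thesis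
    by (simp only: absorb ab[symmetric])
qed

definition square_absorb_rel :: "('a \<times> 'a) set"
  where "square_absorb_rel =
    {(a, b). a \<in> S \<and> b \<in> S \<and> a \<cdot> a \<cdot> b = a \<cdot> a \<and> b \<cdot> b \<cdot> a = b \<cdot> b}"

text \<open>The square of \<open>a\<close> can be written as \<open>a \<cdot> a \<cdot> b\<close>, a
  product with right factor \<open>b\<close>, so it inherits the absorption of \<open>c\<close> from
  \<open>b\<close>.\<close>

lemma square_absorb_trans:
  assumes S: "a \<in> S" "b \<in> S" "c \<in> S"
    and ab: "a \<cdot> a \<cdot> b = a \<cdot> a" and bc: "b \<cdot> b \<cdot> c = b \<cdot> b"
  shows "a \<cdot> a \<cdot> c = a \<cdot> a"
  using mult_absorb_if_right_factor[of "a \<cdot> a" b c] S ab bc by (simp add: closed)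

text \<open>Since \<open>a \<cdot> c\<close> is idempotent, its square may be replaced by
  \<open>a \<cdot> c\<close> itself. This absorbs \<open>b\<close> through its left factor and then
  \<open>d\<close> through its right factor.\<close>

lemma square_absorb_mult:
  assumes S: "a \<in> S" "b \<in> S" "c \<in> S" "d \<in> S"
    and ab: "a \<cdot> a \<cdot> b = a \<cdot> a" and cd: "c \<cdot> c \<cdot> d = c \<cdot> c"
  shows "a \<cdot> c \<cdot> (a \<cdot> c) \<cdot> (b \<cdot> d) = a \<cdot> c \<cdot> (a \<cdot> c)"
proof -
  have "a \<cdot> c \<cdot> (a \<cdot> c) \<cdot> (b \<cdot> d) = a \<cdot> c \<cdot> b \<cdot> d"
    using S by (simp add: mult_idem) (simp add: assoc closed)
  also have "\<dots> = a \<cdot> c"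
    using mult_absorb_if_left_factor[of a c b] mult_absorb_if_right_factor[of a c d] S ab cd
    by simp
  finally show ?thesis
    using S by (simp add: mult_idem)
qed

lemma semilattice_congruence_square_absorb_rel:
  "semilattice_congruence S mult square_absorb_rel"
proof -
  have cube: "a \<cdot> a \<cdot> a = a \<cdot> a" if "a \<in> S" for a
    using that by (simp add: left_legal)
  have "equiv S square_absorb_rel"
    by (rule equivI)
      (auto simp: square_absorb_rel_def cube intro!: refl_onI symI transI
        intro: square_absorb_trans)
  moreover have "(a \<cdot> c, b \<cdot> d) \<in> square_absorb_rel"
    if "(a, b) \<in> square_absorb_rel" "(c, d) \<in> square_absorb_rel" for a b c d
    using that by (auto simp: square_absorb_rel_def closed square_absorb_mult)
  moreover have "(a \<cdot> a, a) \<in> square_absorb_rel" if "a \<in> S" for a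
    using that by (simp add: square_absorb_rel_def closed mult_idem cube assoc[symmetric])
  \<comment> \<open>One half of the symmetric relation suffices: exchanging \<open>a\<close> and
    \<open>b\<close> gives the other.\<close>
  moreover have "a \<cdot> b \<cdot> (a \<cdot> b) \<cdot> (b \<cdot> a) = a \<cdot> b \<cdot> (a \<cdot> b)" if "a \<in> S" "b \<in> S" for a b
    using that
    by (simp add: closed left_legal mult_absorb_right assoc[symmetric])
  then have "(a \<cdot> b, b \<cdot> a) \<in> square_absorb_rel" if "a \<in> S" "b \<in> S" for a b
    using that by (simp add: square_absorb_rel_def closed)
  ultimately show ?thesis
    unfolding semilattice_congruence_iff congruence_on_def by blast
qed

lemma square_absorbs_if_semilattice_indecomposable:
  assumes "semilattice_indecomposable S mult" "a \<in> S" "b \<in> S"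
  shows "a \<cdot> a \<cdot> b = a \<cdot> a"
proof -
  have "square_absorb_rel = S \<times> S"
    using assms(1) semilattice_congruence_square_absorb_rel
    unfolding semilattice_indecomposable_def by blast
  then have "(a, b) \<in> square_absorb_rel"
    using assms by simp
  then show ?thesis
    by (simp add: square_absorb_rel_def)
qed

lemma left_zero_square_if_square_absorbs:
  assumes absorb: "\<And>a b. a \<in> S \<Longrightarrow> b \<in> S \<Longrightarrow> a \<cdot> a \<cdot> b = a \<cdot> a"
  shows "left_zero_semigroup (square S mult) mult"
proof
  \<comment> \<open>Every product absorbs all of \<open>S\<close> through its left factor; the left
    zero law is the case where \<open>c\<close> is itself a product.\<close>
  have "a \<cdot> b \<cdot> c = a \<cdot> b" if "a \<in> S" "b \<in> S" "c \<in> S" for a b c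
    using that by (simp add: mult_absorb_if_left_factor absorb)
  then show "x \<cdot> y = x" if "x \<in> square S mult" "y \<in> square S mult" for x y
    using that by (auto simp: square_def closed)
  show "square S mult \<noteq> {}"
    using nonempty by (auto simp: square_def)
  show "x \<cdot> y \<in> square S mult" if "x \<in> square S mult" "y \<in> square S mult" for x y
    using that closed unfolding square_def by blast
  show "x \<cdot> y \<cdot> z = x \<cdot> (y \<cdot> z)"
    if "x \<in> square S mult" "y \<in> square S mult" "z \<in> square S mult" for x y z
    using that by (intro assoc) (auto simp: square_def closed)
qed

end

theorem theorem10:
  fixes S :: "'a set"
    and mult :: "'a \<Rightarrow> 'a \<Rightarrow> 'a"  (infixl "\<cdot>" 70)
  assumes "semigroup_on S mult"
  shows "(semilattice_indecomposable S mult \<and> left_legal_semigroup S mult \<longleftrightarrow>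
          left_legal_semigroup S mult \<and> (\<forall>a\<in>S. \<forall>b\<in>S. a \<cdot> a \<cdot> b = a \<cdot> a)) \<and>
         (left_legal_semigroup S mult \<and> (\<forall>a\<in>S. \<forall>b\<in>S. a \<cdot> a \<cdot> b = a \<cdot> a) \<longleftrightarrow>
          left_zero_semigroup (square S mult) mult)"
proof -
  interpret semigroup_on S mult
    by (rule assms)
  show ?thesis
    \<comment> \<open>The square identity is the middle condition: the first two facts exchange it
      with indecomposability, the others with the left zero property of the square.\<close>
    using left_legal_semigroup.square_absorbs_if_semilattice_indecomposable[of S mult]
      semilattice_indecomposable_if_square_absorbs
      left_legal_semigroup.left_zero_square_if_square_absorbs[of S mult]
      left_legal_if_left_zero_square
    by blast
qed

end
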